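(* Let $P$ be a partially ordered set and let $F\subseteq P^P$ be a set of functions $P\to P$. (i) For $X\subseteq P$ and $i\in\{1,2\}$, denote by $\bar X^{FO_i}$ the set of all $x\in P$ such that there is a net in $X$ which $FO_i$-converges to $x$. Then $\bar X^{FO_1}=\bar X^{FO_2}$. (ii) A subset $X\subseteq P$ is $FO_1$-closed if and only if it is $FO_2$-closed. (In particular, taking $F$ to consist of the identity map of $P$ only, $X$ is $O_1$-closed if and only if it is $O_2$-closed.) (iii) The collection of all $FO_1$-closed (equivalently, $FO_2$-closed) subsets of $P$ is the family of closed sets of a topology on $P$. Denote this topology by $\tau_{FO}(P)$. (iv) Let $(Y,\tau)$ be a topological space. For every function $\varphi:P\to Y$ the following assertions are equivalent: (a) $\varphi$ is continuous from $(P,\tau_{FO}(P))$ to $(Y,\tau)$; (b) whenever a net $(x_\gamma)_{\gamma\in\Gamma}$ is $FO_2$-convergent to $x$ in $P$, the net $(\varphi(x_\gamma))_{\gamma\in\Gamma}$ converges to $\varphi(x)$ with respect to $\tau$; (c) whenever a net $(x_\gamma)_{\gamma\in\Gamma}$ is $FO_1$-convergent to $x$ in $P$, the net $(\varphi(x_\gamma))_{\gamma\in\Gamma}$ converges to $\varphi(x)$ with respect to $\tau$.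
   Context: Let $P$ be a poset. A subset $D\subseteq P$ is directed if it is nonempty and every finite subset of $D$ has an upper bound in $D$; dually, a nonempty subset is filtered if every finite subset of it has a lower bound in it. $[a,b]:=\{x\in P: a\le x\le b\}$. A property holds eventually for a net $(x_\gamma)_{\gamma\in\Gamma}$ if there is $\gamma_0\in\Gamma$ such that it holds for $(x_\gamma)_{\gamma\ge\gamma_0}$. $x_\gamma\uparrow x$ means the net is increasing with supremum $x$; $x_\gamma\downarrow x$ means it is decreasing with infimum $x$. $O_1$-convergence: $(x_\gamma)_{\gamma\in\Gamma}$ $O_1$-converges to $x$ if there are nets $(y_\gamma)_{\gamma\in\Gamma}$, $(z_\gamma)_{\gamma\in\Gamma}$ in $P$ (same index set) such that $y_\gamma\uparrow x$, $z_\gamma\downarrow x$ and eventually $y_\gamma\le x_\gamma\le z_\gamma$. $O_2$-convergence: $(x_\gamma)_{\gamma\in\Gamma}$ $O_2$-converges to $x$ if there are a directed subset $M\subseteq P$ and a filtered subset $N\subseteq P$ with $\sup M=\inf N=x$ such that for every $(m,n)\in M\times N$ the net is eventually contained in $[m,n]$. For $F\subseteq P^P$ and $i\in\{1,2\}$, the net $(x_\gamma)$ $FO_i$-converges to $x$ if $(f(x_\gamma))_{\gamma\in\Gamma}$ $O_i$-converges to $f(x)$ for every $f\in F$. A subset $X\subseteq P$ is $FO_i$-closed (respectively $O_i$-closed) if no net in $X$ $FO_i$-converges (respectively $O_i$-converges) to a point outside $X$. *)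

theory Defs
  imports "HOL-Analysis.Analysis" "HOL-Library.Lub_Glb"
begin

definition directed_set :: "'a::order set \<Rightarrow> bool" where
  "directed_set D \<longleftrightarrow> D \<noteq> {} \<and> (\<forall>S\<subseteq>D. finite S \<longrightarrow> (\<exists>u\<in>D. \<forall>s\<in>S. s \<le> u))"

definition filtered_set :: "'a::order set \<Rightarrow> bool" where
  "filtered_set D \<longleftrightarrow> D \<noteq> {} \<and> (\<forall>S\<subseteq>D. finite S \<longrightarrow> (\<exists>l\<in>D. \<forall>s\<in>S. l \<le> s))"

text \<open>
  A net is a pair of a directed preorder \<open>r\<close> and a function \<open>x\<close> on the index type. Its index
  set is \<open>Field r\<close>, and \<open>(g, h) \<in> r\<close> means that \<open>g\<close> is below \<open>h\<close>. The values of \<open>x\<close> outside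
  \<open>Field r\<close> are irrelevant.
\<close>

definition directed_index :: "'i rel \<Rightarrow> bool" where
  "directed_index r \<longleftrightarrow> Preorder r \<and> Field r \<noteq> {} \<and>
     (\<forall>S\<subseteq>Field r. finite S \<longrightarrow> (\<exists>u\<in>Field r. \<forall>s\<in>S. (s, u) \<in> r))"

definition net_filter :: "'i rel \<Rightarrow> 'i filter" where
  "net_filter r = (INF g\<in>Field r. principal {h. (g, h) \<in> r})"

lemma eventually_net_filter:
  assumes "directed_index r"
  shows "eventually Q (net_filter r) \<longleftrightarrow> (\<exists>g\<in>Field r. \<forall>h. (g, h) \<in> r \<longrightarrow> Q h)"
proof -
  have ne: "Field r \<noteq> {}" and tr: "trans r"
    and dir: "\<And>S. S \<subseteq> Field r \<Longrightarrow> finite S \<Longrightarrow> \<exists>u\<in>Field r. \<forall>s\<in>S. (s, u) \<in> r"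
    using assms by (auto simp: directed_index_def preorder_on_def)
  have base: "\<exists>u\<in>Field r. principal {h. (u, h) \<in> r}
      \<le> inf (principal {h. (a, h) \<in> r}) (principal {h. (b, h) \<in> r})"
    if "a \<in> Field r" "b \<in> Field r" for a b
  proof -
    have "\<exists>u\<in>Field r. (a, u) \<in> r \<and> (b, u) \<in> r"
      using dir[of "{a, b}"] that by simp
    then obtain u where u: "u \<in> Field r" "(a, u) \<in> r" "(b, u) \<in> r"
      by blast
    have "{h. (u, h) \<in> r} \<subseteq> {h. (a, h) \<in> r} \<inter> {h. (b, h) \<in> r}"
      using u tr by (auto dest: transD)
    then show ?thesis using u(1) by auto
  qed
  show ?thesis
    unfolding net_filter_def
    by (subst eventually_INF_base[OF ne base]) (auto simp: eventually_principal)
qed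

definition O1_converges :: "'i rel \<Rightarrow> ('i \<Rightarrow> 'a::order) \<Rightarrow> 'a \<Rightarrow> bool" where
  "O1_converges r x l \<longleftrightarrow> (\<exists>y z.
     monotone_on (Field r) (\<lambda>g h. (g, h) \<in> r) (\<le>) y \<and> isLub UNIV (y ` Field r) l \<and>
     monotone_on (Field r) (\<lambda>g h. (g, h) \<in> r) (\<ge>) z \<and> isGlb UNIV (z ` Field r) l \<and>
     eventually (\<lambda>g. y g \<le> x g \<and> x g \<le> z g) (net_filter r))"

definition O2_converges :: "'i rel \<Rightarrow> ('i \<Rightarrow> 'a::order) \<Rightarrow> 'a \<Rightarrow> bool" where
  "O2_converges r x l \<longleftrightarrow> (\<exists>M N. directed_set M \<and> filtered_set N \<and>
     isLub UNIV M l \<and> isGlb UNIV N l \<and>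
     (\<forall>m\<in>M. \<forall>n\<in>N. eventually (\<lambda>g. m \<le> x g \<and> x g \<le> n) (net_filter r)))"

definition FO1_converges ::
  "('a::order \<Rightarrow> 'a) set \<Rightarrow> 'i rel \<Rightarrow> ('i \<Rightarrow> 'a) \<Rightarrow> 'a \<Rightarrow> bool" where
  "FO1_converges F r x l \<longleftrightarrow> (\<forall>f\<in>F. O1_converges r (\<lambda>g. f (x g)) (f l))"

definition FO2_converges ::
  "('a::order \<Rightarrow> 'a) set \<Rightarrow> 'i rel \<Rightarrow> ('i \<Rightarrow> 'a) \<Rightarrow> 'a \<Rightarrow> bool" where
  "FO2_converges F r x l \<longleftrightarrow> (\<forall>f\<in>F. O2_converges r (\<lambda>g. f (x g)) (f l))"

text \<open>
  The following notions quantify over all nets whose indices belong to the index type \<open>'i\<close> of the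
  given notion of convergence \<open>conv\<close>.
\<close>

definition net_closure ::
  "('i rel \<Rightarrow> ('i \<Rightarrow> 'a) \<Rightarrow> 'a \<Rightarrow> bool) \<Rightarrow> 'a set \<Rightarrow> 'a set" where
  "net_closure conv X =
     {l. \<exists>r x. directed_index r \<and> (\<forall>g\<in>Field r. x g \<in> X) \<and> conv r x l}"

definition net_closed ::
  "('i rel \<Rightarrow> ('i \<Rightarrow> 'a) \<Rightarrow> 'a \<Rightarrow> bool) \<Rightarrow> 'a set \<Rightarrow> bool" where
  "net_closed conv X \<longleftrightarrow>
     \<not> (\<exists>r x l. directed_index r \<and> (\<forall>g\<in>Field r. x g \<in> X) \<and> conv r x l \<and> l \<notin> X)"

definition preserves_nets ::
  "('i rel \<Rightarrow> ('i \<Rightarrow> 'a) \<Rightarrow> 'a \<Rightarrow> bool) \<Rightarrow> 'b topology \<Rightarrow> ('a \<Rightarrow> 'b) \<Rightarrow> bool" where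
  "preserves_nets conv Y \<phi> \<longleftrightarrow>
     (\<forall>r x l. directed_index r \<and> conv r x l \<longrightarrow>
        limitin Y (\<lambda>g. \<phi> (x g)) (\<phi> l) (net_filter r))"

definition FO1_closure_ix ::
  "'i itself \<Rightarrow> ('a::order \<Rightarrow> 'a) set \<Rightarrow> 'a set \<Rightarrow> 'a set" where
  "FO1_closure_ix _ F = net_closure (FO1_converges F :: 'i rel \<Rightarrow> _)"

definition FO2_closure_ix ::
  "'i itself \<Rightarrow> ('a::order \<Rightarrow> 'a) set \<Rightarrow> 'a set \<Rightarrow> 'a set" where
  "FO2_closure_ix _ F = net_closure (FO2_converges F :: 'i rel \<Rightarrow> _)"

definition FO1_closed_ix :: "'i itself \<Rightarrow> ('a::order \<Rightarrow> 'a) set \<Rightarrow> 'a set \<Rightarrow> bool" where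
  "FO1_closed_ix _ F = net_closed (FO1_converges F :: 'i rel \<Rightarrow> _)"

definition FO2_closed_ix :: "'i itself \<Rightarrow> ('a::order \<Rightarrow> 'a) set \<Rightarrow> 'a set \<Rightarrow> bool" where
  "FO2_closed_ix _ F = net_closed (FO2_converges F :: 'i rel \<Rightarrow> _)"

definition O1_closed_ix :: "'i itself \<Rightarrow> 'a::order set \<Rightarrow> bool" where
  "O1_closed_ix _ = net_closed (O1_converges :: 'i rel \<Rightarrow> _)"

definition O2_closed_ix :: "'i itself \<Rightarrow> 'a::order set \<Rightarrow> bool" where
  "O2_closed_ix _ = net_closed (O2_converges :: 'i rel \<Rightarrow> _)"

definition preserves_FO1_ix ::
  "'i itself \<Rightarrow> ('a::order \<Rightarrow> 'a) set \<Rightarrow> 'b topology \<Rightarrow> ('a \<Rightarrow> 'b) \<Rightarrow> bool" where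
  "preserves_FO1_ix _ F = preserves_nets (FO1_converges F :: 'i rel \<Rightarrow> _)"

definition preserves_FO2_ix ::
  "'i itself \<Rightarrow> ('a::order \<Rightarrow> 'a) set \<Rightarrow> 'b topology \<Rightarrow> ('a \<Rightarrow> 'b) \<Rightarrow> bool" where
  "preserves_FO2_ix _ F = preserves_nets (FO2_converges F :: 'i rel \<Rightarrow> _)"

text \<open>
  HOL cannot quantify over the index type inside a formula. The unqualified notions below
  therefore use one index type that is large enough to replace a net over any other type. An
  index \<open>(S, m, n, p)\<close> accommodates a finite set \<open>S\<close> of functions in \<open>F\<close>, bounds \<open>m f\<close> and \<open>n f\<close>
  for each \<open>f \<in> S\<close>, and a point \<open>p\<close> such that \<open>f p\<close> lies between \<open>m f\<close> and \<open>n f\<close> for \<open>f \<in> S\<close>.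
  The theorem also compares them with the notions for an arbitrary index type \<open>'i\<close>.
\<close>

type_synonym 'a net_index =
  "('a \<Rightarrow> 'a) set \<times> (('a \<Rightarrow> 'a) \<Rightarrow> 'a) \<times> (('a \<Rightarrow> 'a) \<Rightarrow> 'a) \<times> 'a"

abbreviation FO1_closure :: "('a::order \<Rightarrow> 'a) set \<Rightarrow> 'a set \<Rightarrow> 'a set" where
  "FO1_closure \<equiv> FO1_closure_ix TYPE('a net_index)"

abbreviation FO2_closure :: "('a::order \<Rightarrow> 'a) set \<Rightarrow> 'a set \<Rightarrow> 'a set" where
  "FO2_closure \<equiv> FO2_closure_ix TYPE('a net_index)"

abbreviation FO1_closed :: "('a::order \<Rightarrow> 'a) set \<Rightarrow> 'a set \<Rightarrow> bool" where
  "FO1_closed \<equiv> FO1_closed_ix TYPE('a net_index)"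

abbreviation FO2_closed :: "('a::order \<Rightarrow> 'a) set \<Rightarrow> 'a set \<Rightarrow> bool" where
  "FO2_closed \<equiv> FO2_closed_ix TYPE('a net_index)"

abbreviation O1_closed :: "'a::order set \<Rightarrow> bool" where
  "O1_closed \<equiv> O1_closed_ix TYPE('a net_index)"

abbreviation O2_closed :: "'a::order set \<Rightarrow> bool" where
  "O2_closed \<equiv> O2_closed_ix TYPE('a net_index)"

abbreviation preserves_FO1 ::
  "('a::order \<Rightarrow> 'a) set \<Rightarrow> 'b topology \<Rightarrow> ('a \<Rightarrow> 'b) \<Rightarrow> bool" where
  "preserves_FO1 \<equiv> preserves_FO1_ix TYPE('a net_index)"

abbreviation preserves_FO2 ::
  "('a::order \<Rightarrow> 'a) set \<Rightarrow> 'b topology \<Rightarrow> ('a \<Rightarrow> 'b) \<Rightarrow> bool" where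
  "preserves_FO2 \<equiv> preserves_FO2_ix TYPE('a net_index)"

definition tau_FO :: "('a::order \<Rightarrow> 'a) set \<Rightarrow> 'a topology" where
  "tau_FO F = topology (\<lambda>U. FO1_closed F (- U))"

end

(*
Whether l is an FO-limit of a net in X can be said without nets: for every f in F there are a
directed set M f and a filtered set N f with supremum and infimum f l, such that any finitely many
intervals [m f, n f] are entered simultaneously by some point of X. Every FO_2-convergent net that
is frequently in X yields this. Conversely, the quadruples of a finite set S of functions, bounds
m and n chosen for all f in F, and a point p of X entering the intervals given by S form a
directed index set along which p FO_1-converges to l: the nets required by O_1-convergence
of f p are simply m f and n f.
*)
theory Submission
  imports Defs
begin

section \<open>Adherence without nets\<close>

text \<open>The families \<open>M\<close> and \<open>N\<close> are fixed before the finite test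
  \<open>(S, m, n)\<close>, and only the values of \<open>m\<close> and \<open>n\<close> on
  \<open>S\<close> matter. The test with \<open>S = {}\<close> makes \<open>X\<close> nonempty, even
  when \<open>F\<close> is empty.\<close>

definition FO_adherent :: "('a::order \<Rightarrow> 'a) set \<Rightarrow> 'a set \<Rightarrow> 'a \<Rightarrow> bool" where
  "FO_adherent F X l \<longleftrightarrow> (\<exists>M N.
     (\<forall>f\<in>F. directed_set (M f) \<and> filtered_set (N f) \<and>
        isLub UNIV (M f) (f l) \<and> isGlb UNIV (N f) (f l)) \<and>
     (\<forall>S m n. finite S \<and> S \<subseteq> F \<and> (\<forall>f\<in>S. m f \<in> M f \<and> n f \<in> N f) \<longrightarrow>
        (\<exists>p\<in>X. \<forall>f\<in>S. m f \<le> f p \<and> f p \<le> n f)))"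

lemma FO_adherentI:
  assumes "\<And>f. f \<in> F \<Longrightarrow> directed_set (M f)" "\<And>f. f \<in> F \<Longrightarrow> filtered_set (N f)"
    and "\<And>f. f \<in> F \<Longrightarrow> isLub UNIV (M f) (f l)" "\<And>f. f \<in> F \<Longrightarrow> isGlb UNIV (N f) (f l)"
    and "\<And>S m n. \<lbrakk>finite S; S \<subseteq> F; \<And>f. f \<in> S \<Longrightarrow> m f \<in> M f; \<And>f. f \<in> S \<Longrightarrow> n f \<in> N f\<rbrakk>
      \<Longrightarrow> \<exists>p\<in>X. \<forall>f\<in>S. m f \<le> f p \<and> f p \<le> n f"
  shows "FO_adherent F X l"
  unfolding FO_adherent_def
  by (rule exI[of _ M], rule exI[of _ N], intro conjI ballI allI impI; (elim conjE)?)
    (simp_all add: assms)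

text \<open>The last fact is stated with nested implications so that \<open>rule_format\<close>
  turns it into a rule producing the point \<open>p\<close>.\<close>

lemma FO_adherentE:
  assumes "FO_adherent F X l"
  obtains M N where
    "\<forall>f\<in>F. directed_set (M f)" "\<forall>f\<in>F. filtered_set (N f)"
    "\<forall>f\<in>F. isLub UNIV (M f) (f l)" "\<forall>f\<in>F. isGlb UNIV (N f) (f l)"
    "\<forall>S m n. finite S \<longrightarrow> S \<subseteq> F \<longrightarrow> (\<forall>f\<in>S. m f \<in> M f) \<longrightarrow> (\<forall>f\<in>S. n f \<in> N f) \<longrightarrow>
      (\<exists>p\<in>X. \<forall>f\<in>S. m f \<le> f p \<and> f p \<le> n f)"
proof -
  obtain M N where MN: "\<forall>f\<in>F. directed_set (M f) \<and> filtered_set (N f) \<and>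
        isLub UNIV (M f) (f l) \<and> isGlb UNIV (N f) (f l)"
    and X: "\<forall>S m n. finite S \<and> S \<subseteq> F \<and> (\<forall>f\<in>S. m f \<in> M f \<and> n f \<in> N f) \<longrightarrow>
        (\<exists>p\<in>X. \<forall>f\<in>S. m f \<le> f p \<and> f p \<le> n f)"
    using assms unfolding FO_adherent_def by (elim exE conjE)
  show thesis
    by (rule that[of M N]) (use MN X in simp_all)
qed

section \<open>Directed sets and directed index sets\<close>

lemma directed_set_nonempty: "directed_set D \<Longrightarrow> D \<noteq> {}"
  by (simp add: directed_set_def)

lemma filtered_set_nonempty: "filtered_set D \<Longrightarrow> D \<noteq> {}"
  by (simp add: filtered_set_def)

lemma directed_set_ub2:
  assumes "directed_set D" "a \<in> D" "b \<in> D"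
  obtains u where "u \<in> D" "a \<le> u" "b \<le> u"
proof -
  have "\<exists>u\<in>D. \<forall>s\<in>{a, b}. s \<le> u"
    using assms unfolding directed_set_def by (metis empty_subsetI finite.simps insert_subset)
  then show ?thesis using that by auto
qed

lemma filtered_set_lb2:
  assumes "filtered_set D" "a \<in> D" "b \<in> D"
  obtains u where "u \<in> D" "u \<le> a" "u \<le> b"
proof -
  have "\<exists>u\<in>D. \<forall>s\<in>{a, b}. u \<le> s"
    using assms unfolding filtered_set_def by (metis empty_subsetI finite.simps insert_subset)
  then show ?thesis using that by auto
qed

text \<open>By transitivity, upper bounds of pairs extend to finite sets by induction; nonemptiness
  of the field settles the empty set.\<close>

lemma directed_indexI:
  assumes "Preorder r" "Field r \<noteq> {}"
    and ub: "\<And>a b. \<lbrakk>a \<in> Field r; b \<in> Field r\<rbrakk> \<Longrightarrow> \<exists>u\<in>Field r. (a, u) \<in> r \<and> (b, u) \<in> r"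
  shows "directed_index r"
  unfolding directed_index_def
proof (intro conjI allI impI)
  have tr: "trans r" using assms(1) by (simp add: preorder_on_def)
  fix S assume "S \<subseteq> Field r" "finite S"
  from this(2,1) show "\<exists>u\<in>Field r. \<forall>s\<in>S. (s, u) \<in> r"
  proof (induction S rule: finite_induct)
    case empty
    then show ?case using assms(2) by blast
  next
    case (insert a S)
    then obtain u where u: "u \<in> Field r" "\<forall>s\<in>S. (s, u) \<in> r" by auto
    with ub insert.prems obtain v where v: "v \<in> Field r" "(a, v) \<in> r" "(u, v) \<in> r" by blast
    then show ?case using u tr by (auto dest: transD)
  qed
qed (use assms in auto)

text \<open>By reflexivity every tail contains the index at which it starts, so no tail is
  empty.\<close>

lemma net_filter_neq_bot:
  assumes "directed_index r"
  shows "net_filter r \<noteq> bot"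
proof
  assume "net_filter r = bot"
  then have "eventually (\<lambda>_. False) (net_filter r)" by simp
  then obtain g where "g \<in> Field r" "\<forall>h. (g, h) \<notin> r"
    unfolding eventually_net_filter[OF assms] by auto
  then show False
    using assms by (auto simp: directed_index_def preorder_on_def refl_on_def)
qed

lemma eventually_net_filter_Field:
  assumes "directed_index r"
  shows "eventually (\<lambda>g. g \<in> Field r) (net_filter r)"
  unfolding eventually_net_filter[OF assms]
  using assms by (auto simp: directed_index_def intro: FieldI2)

section \<open>From convergent nets to adherence\<close>

text \<open>The ranges of \<open>y\<close> and \<open>z\<close> over the index set serve as
  \<open>M\<close> and \<open>N\<close>: monotone images of a directed index set are directed,
  respectively filtered. For given indices \<open>a\<close> and \<open>b\<close>, every
  \<open>g\<close> above both satisfies \<open>y a \<le> y g\<close> and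
  \<open>z g \<le> z b\<close>, so the net is eventually in the interval from \<open>y a\<close> to
  \<open>z b\<close>.\<close>

lemma O1_converges_imp_O2_converges:
  assumes r: "directed_index r" and O1: "O1_converges r x l"
  shows "O2_converges r x l"
proof -
  obtain y z where
    y: "monotone_on (Field r) (\<lambda>g h. (g, h) \<in> r) (\<le>) y" "isLub UNIV (y ` Field r) l" and
    z: "monotone_on (Field r) (\<lambda>g h. (g, h) \<in> r) (\<ge>) z" "isGlb UNIV (z ` Field r) l" and
    ev: "eventually (\<lambda>g. y g \<le> x g \<and> x g \<le> z g) (net_filter r)"
    using O1 unfolding O1_converges_def by blast
  have ne: "Field r \<noteq> {}"
    and dir: "\<And>S. S \<subseteq> Field r \<Longrightarrow> finite S \<Longrightarrow> \<exists>u\<in>Field r. \<forall>s\<in>S. (s, u) \<in> r"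
    using r by (auto simp: directed_index_def)
  have "directed_set (y ` Field r)"
    unfolding directed_set_def
  proof (intro conjI allI impI)
    fix S assume "S \<subseteq> y ` Field r" "finite S"
    then obtain T where T: "T \<subseteq> Field r" "finite T" "S = y ` T"
      by (meson finite_subset_image)
    with dir obtain u where "u \<in> Field r" "\<forall>s\<in>T. (s, u) \<in> r" by blast
    moreover from this have "\<forall>s\<in>S. s \<le> y u"
      using T y(1) unfolding monotone_on_def by blast
    ultimately show "\<exists>u\<in>y ` Field r. \<forall>s\<in>S. s \<le> u" by blast
  qed (use ne in auto)
  moreover have "filtered_set (z ` Field r)"
    unfolding filtered_set_def
  proof (intro conjI allI impI)
    fix S assume "S \<subseteq> z ` Field r" "finite S"
    then obtain T where T: "T \<subseteq> Field r" "finite T" "S = z ` T"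
      by (meson finite_subset_image)
    with dir obtain u where "u \<in> Field r" "\<forall>s\<in>T. (s, u) \<in> r" by blast
    moreover from this have "\<forall>s\<in>S. z u \<le> s"
      using T z(1) unfolding monotone_on_def by blast
    ultimately show "\<exists>u\<in>z ` Field r. \<forall>s\<in>S. u \<le> s" by blast
  qed (use ne in auto)
  moreover have "eventually (\<lambda>g. y a \<le> x g \<and> x g \<le> z b) (net_filter r)"
    if "a \<in> Field r" "b \<in> Field r" for a b
  proof -
    have "eventually (\<lambda>g. (a, g) \<in> r) (net_filter r)" "eventually (\<lambda>g. (b, g) \<in> r) (net_filter r)"
      using that unfolding eventually_net_filter[OF r] by auto
    with ev show ?thesis
    proof eventually_elim
      case (elim g)
      then have "g \<in> Field r" by (auto intro: FieldI2)
      then have "y a \<le> y g" "z g \<le> z b"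
        using that elim y(1) z(1) by (auto simp: monotone_on_def)
      then show ?case using elim by (meson order_trans)
    qed
  qed
  ultimately show ?thesis
    using y(2) z(2) unfolding O2_converges_def by blast
qed

lemma FO1_converges_imp_FO2_converges:
  "\<lbrakk>directed_index r; FO1_converges F r x l\<rbrakk> \<Longrightarrow> FO2_converges F r x l"
  by (simp add: FO1_converges_def FO2_converges_def O1_converges_imp_O2_converges)

text \<open>The finitely many conditions indexed by \<open>S\<close> eventually hold together, and
  hence at some index where the net is in \<open>X\<close>. Assuming only that the net is frequently
  in \<open>X\<close> lets the lemma serve the continuity argument too, where a net that is not
  eventually in an open set is frequently in its complement.\<close>

lemma FO2_converges_imp_FO_adherent:
  assumes r: "directed_index r" and conv: "FO2_converges F r x l"
    and fr: "frequently (\<lambda>g. x g \<in> X) (net_filter r)"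
  shows "FO_adherent F X l"
proof -
  have "\<forall>f\<in>F. \<exists>M N. directed_set M \<and> filtered_set N \<and> isLub UNIV M (f l) \<and> isGlb UNIV N (f l) \<and>
      (\<forall>m\<in>M. \<forall>n\<in>N. eventually (\<lambda>g. m \<le> f (x g) \<and> f (x g) \<le> n) (net_filter r))"
    using conv unfolding FO2_converges_def O2_converges_def .
  from bchoice[OF this] obtain M where M: "\<forall>f\<in>F. \<exists>N. directed_set (M f) \<and> filtered_set N \<and>
      isLub UNIV (M f) (f l) \<and> isGlb UNIV N (f l) \<and>
      (\<forall>m\<in>M f. \<forall>n\<in>N. eventually (\<lambda>g. m \<le> f (x g) \<and> f (x g) \<le> n) (net_filter r))" ..
  from bchoice[OF M] obtain N where MN: "\<forall>f\<in>F. directed_set (M f) \<and> filtered_set (N f) \<and>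
      isLub UNIV (M f) (f l) \<and> isGlb UNIV (N f) (f l) \<and>
      (\<forall>m\<in>M f. \<forall>n\<in>N f. eventually (\<lambda>g. m \<le> f (x g) \<and> f (x g) \<le> n) (net_filter r))" ..
  show ?thesis
  proof (rule FO_adherentI[of F M N])
    fix S m n assume S: "finite S" "S \<subseteq> F"
      and m: "\<And>f. f \<in> S \<Longrightarrow> m f \<in> M f" and n: "\<And>f. f \<in> S \<Longrightarrow> n f \<in> N f"
    have "eventually (\<lambda>g. \<forall>f\<in>S. m f \<le> f (x g) \<and> f (x g) \<le> n f) (net_filter r)"
      using S MN m n by (intro eventually_ball_finite) auto
    then have "\<exists>g. x g \<in> X \<and> (\<forall>f\<in>S. m f \<le> f (x g) \<and> f (x g) \<le> n f)"
      using frequently_eventually_frequently[OF fr] frequently_ex by blast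
    then show "\<exists>p\<in>X. \<forall>f\<in>S. m f \<le> f p \<and> f p \<le> n f" by blast
  qed (use MN in auto)
qed

section \<open>From adherence to a convergent net\<close>

lemma FO_adherent_imp_net:
  fixes F :: "('a::order \<Rightarrow> 'a) set"
  assumes "FO_adherent F X l"
  obtains r :: "'a net_index rel" and x
  where "directed_index r" "\<forall>g\<in>Field r. x g \<in> X" "FO1_converges F r x l"
proof -
  obtain M N where dir_M [rule_format]: "\<forall>f\<in>F. directed_set (M f)"
    and filt_N [rule_format]: "\<forall>f\<in>F. filtered_set (N f)"
    and lub_M [rule_format]: "\<forall>f\<in>F. isLub UNIV (M f) (f l)"
    and glb_N [rule_format]: "\<forall>f\<in>F. isGlb UNIV (N f) (f l)"
    and X [rule_format]: "\<forall>S m n. finite S \<longrightarrow> S \<subseteq> F \<longrightarrow>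
      (\<forall>f\<in>S. m f \<in> M f) \<longrightarrow> (\<forall>f\<in>S. n f \<in> N f) \<longrightarrow>
      (\<exists>p\<in>X. \<forall>f\<in>S. m f \<le> f p \<and> f p \<le> n f)"
    by (rule FO_adherentE[OF assms])
  \<comment> \<open>The bounds are chosen on all of \<open>F\<close>, so that each \<open>f\<close>
    has a lower and an upper bound at every index. The point \<open>p\<close> is tested only on the
    finite set \<open>S\<close>, which is what adherence can guarantee.\<close>
  define I :: "'a net_index set" where "I = {(S, m, n, p). finite S \<and> S \<subseteq> F \<and>
    (\<forall>f\<in>F. m f \<in> M f \<and> n f \<in> N f) \<and> p \<in> X \<and> (\<forall>f\<in>S. m f \<le> f p \<and> f p \<le> n f)}"
  \<comment> \<open>Neither the point nor the values of the bounds outside \<open>F\<close> are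
    compared, so \<open>r\<close> is in general only a preorder. Comparing the bounds on all of
    \<open>F\<close>, not only on \<open>S\<close>, makes \<open>m f\<close> increase and
    \<open>n f\<close> decrease along the whole index set.\<close>
  define r :: "'a net_index rel" where "r = {((S, m, n, p), (S', m', n', p')).
    (S, m, n, p) \<in> I \<and> (S', m', n', p') \<in> I \<and> S \<subseteq> S' \<and> (\<forall>f\<in>F. m f \<le> m' f \<and> n' f \<le> n f)}"
  define x :: "'a net_index \<Rightarrow> 'a" where "x = (\<lambda>(S, m, n, p). p)"
  have point: "\<exists>p. (S, m, n, p) \<in> I"
    if "finite S" "S \<subseteq> F" "\<And>f. f \<in> F \<Longrightarrow> m f \<in> M f" "\<And>f. f \<in> F \<Longrightarrow> n f \<in> N f" for S m n
  proof -
    have "\<exists>p\<in>X. \<forall>f\<in>S. m f \<le> f p \<and> f p \<le> n f"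
      by (rule X) (use that in auto)
    then show ?thesis using that unfolding I_def by auto
  qed
  have refl: "(i, i) \<in> r" if "i \<in> I" for i
    using that by (auto simp: r_def)
  have Field: "Field r = I"
    using refl by (auto simp: Field_def r_def)
  \<comment> \<open>The default bounds \<open>m0\<close> and \<open>n0\<close> complete an index in
    which at most one bound is prescribed.\<close>
  have "\<forall>f\<in>F. \<exists>u. u \<in> M f" "\<forall>f\<in>F. \<exists>u. u \<in> N f"
    using directed_set_nonempty[OF dir_M] filtered_set_nonempty[OF filt_N] by blast+
  then obtain m0 n0 where m0: "\<And>f. f \<in> F \<Longrightarrow> m0 f \<in> M f" and n0: "\<And>f. f \<in> F \<Longrightarrow> n0 f \<in> N f"
    by metis
  have dir: "directed_index r"
  proof (rule directed_indexI)
    have "r \<subseteq> Field r \<times> Field r" by (auto simp: Field_def)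
    moreover have "trans r"
    proof (rule transI)
      fix a b c assume "(a, b) \<in> r" "(b, c) \<in> r"
      then show "(a, c) \<in> r"
        unfolding r_def by (cases a; cases b; cases c) (auto intro: order_trans)
    qed
    ultimately show "Preorder r"
      using refl by (auto simp: preorder_on_def refl_on_def Field)
    show "Field r \<noteq> {}"
      using point[of "{}" m0 n0] m0 n0 by (auto simp: Field)
    fix a b assume ab: "a \<in> Field r" "b \<in> Field r"
    obtain S m n p S' m' n' p' where eq: "a = (S, m, n, p)" "b = (S', m', n', p')"
      by (metis prod_cases4)
    have *: "m f \<in> M f" "n f \<in> N f" "m' f \<in> M f" "n' f \<in> N f" if "f \<in> F" for f
      using ab that by (auto simp: eq Field I_def)
    have "\<forall>f\<in>F. \<exists>u\<in>M f. m f \<le> u \<and> m' f \<le> u"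
      using * dir_M directed_set_ub2 by metis
    then obtain m'' where m'': "\<And>f. f \<in> F \<Longrightarrow> m'' f \<in> M f \<and> m f \<le> m'' f \<and> m' f \<le> m'' f"
      by metis
    have "\<forall>f\<in>F. \<exists>u\<in>N f. u \<le> n f \<and> u \<le> n' f"
      using * filt_N filtered_set_lb2 by metis
    then obtain n'' where n'': "\<And>f. f \<in> F \<Longrightarrow> n'' f \<in> N f \<and> n'' f \<le> n f \<and> n'' f \<le> n' f"
      by metis
    have "finite (S \<union> S')" "S \<union> S' \<subseteq> F"
      using ab by (auto simp: eq Field I_def)
    \<comment> \<open>The points \<open>p\<close> and \<open>p'\<close> may violate the sharper
      bounds, so a new point is chosen; this is harmless because \<open>r\<close> ignores
      points.\<close>
    then obtain q where "(S \<union> S', m'', n'', q) \<in> I"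
      using point[of "S \<union> S'" m'' n''] m'' n'' by auto
    then show "\<exists>u\<in>Field r. (a, u) \<in> r \<and> (b, u) \<in> r"
      using ab m'' n'' unfolding eq Field by (intro bexI) (auto simp: r_def)
  qed
  have "O1_converges r (\<lambda>g. f (x g)) (f l)" if f: "f \<in> F" for f
  proof -
    define y z :: "'a net_index \<Rightarrow> 'a" where "y = (\<lambda>(S, m, n, p). m f)" and "z = (\<lambda>(S, m, n, p). n f)"
    have "y ` I = M f"
    proof
      show "M f \<subseteq> y ` I"
      proof
        fix u assume "u \<in> M f"
        \<comment> \<open>With the empty set of functions the bounds put no constraint on the point,
          so any \<open>u\<close> in \<open>M f\<close> occurs as the bound of some index. Hence
          \<open>y\<close> has exactly \<open>M f\<close> as its range, and its supremum is
          \<open>f l\<close>.\<close>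
        have "\<exists>p. ({}, m0(f := u), n0, p) \<in> I"
          by (rule point) (use \<open>u \<in> M f\<close> m0 n0 in auto)
        then obtain p where "({}, m0(f := u), n0, p) \<in> I" ..
        then show "u \<in> y ` I" by (rule rev_image_eqI) (simp add: y_def)
      qed
    qed (use f in \<open>auto simp: y_def I_def\<close>)
    moreover have "z ` I = N f"
    proof
      show "N f \<subseteq> z ` I"
      proof
        fix u assume "u \<in> N f"
        have "\<exists>p. ({}, m0, n0(f := u), p) \<in> I"
          by (rule point) (use \<open>u \<in> N f\<close> m0 n0 in auto)
        then obtain p where "({}, m0, n0(f := u), p) \<in> I" ..
        then show "u \<in> z ` I" by (rule rev_image_eqI) (simp add: z_def)
      qed
    qed (use f in \<open>auto simp: z_def I_def\<close>)
    moreover have "monotone_on (Field r) (\<lambda>g h. (g, h) \<in> r) (\<le>) y"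
      "monotone_on (Field r) (\<lambda>g h. (g, h) \<in> r) (\<ge>) z"
      using f by (auto simp: monotone_on_def r_def y_def z_def)
    moreover have "eventually (\<lambda>g. y g \<le> f (x g) \<and> f (x g) \<le> z g) (net_filter r)"
    proof -
      \<comment> \<open>Every index above this one has \<open>f\<close> in its finite set, so its
        point satisfies the bounds for \<open>f\<close>.\<close>
      obtain p where "({f}, m0, n0, p) \<in> I"
        using point[of "{f}" m0 n0] m0 n0 f by auto
      then show ?thesis
        unfolding eventually_net_filter[OF dir] Field
        by (rule rev_bexI) (auto simp: r_def I_def x_def y_def z_def)
    qed
    ultimately show ?thesis
      unfolding O1_converges_def using lub_M[OF f] glb_N[OF f]
      by (intro exI[of _ y] exI[of _ z] conjI) (simp_all add: Field)
  qed
  then have "FO1_converges F r x l" by (simp add: FO1_converges_def)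
  moreover have "\<forall>g\<in>Field r. x g \<in> X"
    by (auto simp: Field I_def x_def)
  ultimately show ?thesis using dir that by blast
qed

section \<open>Closures and closed sets\<close>

text \<open>The index type is arbitrary here. Together with the net built from adherence, this shows
  that \<open>'a net_index\<close> already reaches every limit attainable with any other index
  type.\<close>

lemma FO2_closure_ix_subset: "FO2_closure_ix TYPE('i) F X \<subseteq> {l. FO_adherent F X l}"
proof
  fix l assume "l \<in> FO2_closure_ix TYPE('i) F X"
  then obtain r :: "'i rel" and x where
    r: "directed_index r" "\<forall>g\<in>Field r. x g \<in> X" "FO2_converges F r x l"
    by (auto simp: FO2_closure_ix_def net_closure_def)
  have "eventually (\<lambda>g. x g \<in> X) (net_filter r)"
    using eventually_net_filter_Field[OF r(1)] by eventually_elim (use r(2) in auto)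
  then have "frequently (\<lambda>g. x g \<in> X) (net_filter r)"
    by (rule eventually_frequently[OF net_filter_neq_bot[OF r(1)]])
  with r show "l \<in> {l. FO_adherent F X l}"
    by (simp add: FO2_converges_imp_FO_adherent)
qed

lemma FO1_closure_ix_subset_FO2: "FO1_closure_ix TYPE('i) F X \<subseteq> FO2_closure_ix TYPE('i) F X"
  unfolding FO1_closure_ix_def FO2_closure_ix_def net_closure_def
  using FO1_converges_imp_FO2_converges by blast

text \<open>The \<open>FO1\<close> closure lies in the \<open>FO2\<close> closure, which lies in the
  set of adherent points; the constructed net closes the circle.\<close>

lemma FO1_closure_eq: "FO1_closure F X = {l. FO_adherent F X l}"
proof
  show "{l. FO_adherent F X l} \<subseteq> FO1_closure F X"
    unfolding FO1_closure_ix_def net_closure_def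
    by (auto elim!: FO_adherent_imp_net)
qed (use FO1_closure_ix_subset_FO2 FO2_closure_ix_subset in blast)

lemma FO2_closure_eq: "FO2_closure F X = {l. FO_adherent F X l}"
  using FO1_closure_eq FO1_closure_ix_subset_FO2 FO2_closure_ix_subset by blast

lemma net_closed_iff: "net_closed conv X \<longleftrightarrow> net_closure conv X \<subseteq> X"
  by (auto simp: net_closed_def net_closure_def)

lemma FO1_closed_ix_iff: "FO1_closed_ix TYPE('i) F X \<longleftrightarrow> FO1_closure_ix TYPE('i) F X \<subseteq> X"
  by (simp add: FO1_closed_ix_def FO1_closure_ix_def net_closed_iff)

lemma FO2_closed_ix_iff: "FO2_closed_ix TYPE('i) F X \<longleftrightarrow> FO2_closure_ix TYPE('i) F X \<subseteq> X"
  by (simp add: FO2_closed_ix_def FO2_closure_ix_def net_closed_iff)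

lemma FO1_closed_iff: "FO1_closed F X \<longleftrightarrow> (\<forall>l. FO_adherent F X l \<longrightarrow> l \<in> X)"
  unfolding FO1_closed_ix_iff FO1_closure_eq by blast

lemma FO2_closed_iff: "FO2_closed F X \<longleftrightarrow> (\<forall>l. FO_adherent F X l \<longrightarrow> l \<in> X)"
  unfolding FO2_closed_ix_iff FO2_closure_eq by blast

lemma O1_closed_ix_eq: "O1_closed_ix TYPE('i) X \<longleftrightarrow> FO1_closed_ix TYPE('i) {id} X"
  by (simp add: O1_closed_ix_def FO1_closed_ix_def FO1_converges_def[abs_def])

lemma O2_closed_ix_eq: "O2_closed_ix TYPE('i) X \<longleftrightarrow> FO2_closed_ix TYPE('i) {id} X"
  by (simp add: O2_closed_ix_def FO2_closed_ix_def FO2_converges_def[abs_def])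

section \<open>The topology of closed sets\<close>

lemma FO_adherent_mono:
  assumes "FO_adherent F X l" "X \<subseteq> X'"
  shows "FO_adherent F X' l"
proof -
  obtain M N where MN: "\<forall>f\<in>F. directed_set (M f)" "\<forall>f\<in>F. filtered_set (N f)"
    "\<forall>f\<in>F. isLub UNIV (M f) (f l)" "\<forall>f\<in>F. isGlb UNIV (N f) (f l)"
    and X [rule_format]: "\<forall>S m n. finite S \<longrightarrow> S \<subseteq> F \<longrightarrow>
      (\<forall>f\<in>S. m f \<in> M f) \<longrightarrow> (\<forall>f\<in>S. n f \<in> N f) \<longrightarrow>
      (\<exists>p\<in>X. \<forall>f\<in>S. m f \<le> f p \<and> f p \<le> n f)"
    by (rule FO_adherentE[OF assms(1)])
  show ?thesis
  proof (rule FO_adherentI[of F M N])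
    fix S m n
    assume "finite S" "S \<subseteq> F" "\<And>f. f \<in> S \<Longrightarrow> m f \<in> M f" "\<And>f. f \<in> S \<Longrightarrow> n f \<in> N f"
    then have "\<exists>p\<in>X. \<forall>f\<in>S. m f \<le> f p \<and> f p \<le> n f" by (rule X)
    then show "\<exists>p\<in>X'. \<forall>f\<in>S. m f \<le> f p \<and> f p \<le> n f" using assms(2) by blast
  qed (simp_all add: MN)
qed

lemma not_FO_adherent_empty: "\<not> FO_adherent F {} l"
proof
  assume "FO_adherent F {} l"
  then show False
    by (rule FO_adherentE) (drule spec[of _ "{}"], simp)
qed

text \<open>Fix \<open>M\<close> and \<open>N\<close> witnessing adherence to the union. If
  \<open>l\<close> were adherent to neither set, each would fail some finite test for this same
  pair. One test refining both would then fail on the whole union.\<close>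

lemma FO_adherent_Un:
  assumes "FO_adherent F (X \<union> X') l"
  shows "FO_adherent F X l \<or> FO_adherent F X' l"
proof -
  obtain M N where dir_M [rule_format]: "\<forall>f\<in>F. directed_set (M f)"
    and filt_N [rule_format]: "\<forall>f\<in>F. filtered_set (N f)"
    and lub_M [rule_format]: "\<forall>f\<in>F. isLub UNIV (M f) (f l)"
    and glb_N [rule_format]: "\<forall>f\<in>F. isGlb UNIV (N f) (f l)"
    and XX' [rule_format]: "\<forall>S m n. finite S \<longrightarrow> S \<subseteq> F \<longrightarrow>
      (\<forall>f\<in>S. m f \<in> M f) \<longrightarrow> (\<forall>f\<in>S. n f \<in> N f) \<longrightarrow>
      (\<exists>p\<in>X \<union> X'. \<forall>f\<in>S. m f \<le> f p \<and> f p \<le> n f)"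
    by (rule FO_adherentE[OF assms])
  show ?thesis
  proof (rule ccontr)
    assume "\<not> ?thesis"
    then have nX: "\<not> FO_adherent F X l" and nX': "\<not> FO_adherent F X' l" by auto
    have escape: "\<exists>S m n. finite S \<and> S \<subseteq> F \<and> (\<forall>f\<in>S. m f \<in> M f \<and> n f \<in> N f) \<and>
        (\<forall>p\<in>Z. \<not> (\<forall>f\<in>S. m f \<le> f p \<and> f p \<le> n f))" if "\<not> FO_adherent F Z l" for Z
    proof (rule ccontr)
      assume contr: "\<not> ?thesis"
      have "FO_adherent F Z l"
      proof (rule FO_adherentI[of F M N])
        fix S m n
        assume "finite S" "S \<subseteq> F" "\<And>f. f \<in> S \<Longrightarrow> m f \<in> M f" "\<And>f. f \<in> S \<Longrightarrow> n f \<in> N f"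
        with contr[unfolded not_ex, THEN spec[of _ S], THEN spec[of _ m], THEN spec[of _ n]]
        show "\<exists>p\<in>Z. \<forall>f\<in>S. m f \<le> f p \<and> f p \<le> n f" by auto
      qed (simp_all add: dir_M filt_N lub_M glb_N)
      with that show False ..
    qed
    obtain S m n where S: "finite S" "S \<subseteq> F" "\<forall>f\<in>S. m f \<in> M f \<and> n f \<in> N f"
      and nS: "\<forall>p\<in>X. \<not> (\<forall>f\<in>S. m f \<le> f p \<and> f p \<le> n f)"
      using escape[OF nX] by blast
    obtain S' m' n' where S': "finite S'" "S' \<subseteq> F" "\<forall>f\<in>S'. m' f \<in> M f \<and> n' f \<in> N f"
      and nS': "\<forall>p\<in>X'. \<not> (\<forall>f\<in>S'. m' f \<le> f p \<and> f p \<le> n' f)"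
      using escape[OF nX'] by blast
    \<comment> \<open>For \<open>f\<close> in only one of the two sets, the other bound need not lie
      in \<open>M f\<close>, so each inequality is guarded by membership and the one relevant bound
      can itself be taken.\<close>
    have "\<forall>f\<in>S \<union> S'. \<exists>u\<in>M f. (f \<in> S \<longrightarrow> m f \<le> u) \<and> (f \<in> S' \<longrightarrow> m' f \<le> u)"
      using S S' dir_M directed_set_ub2 by (metis Un_iff order_refl subsetD)
    then obtain m'' where m'': "\<And>f. f \<in> S \<union> S' \<Longrightarrow>
        m'' f \<in> M f \<and> (f \<in> S \<longrightarrow> m f \<le> m'' f) \<and> (f \<in> S' \<longrightarrow> m' f \<le> m'' f)"
      by metis
    have "\<forall>f\<in>S \<union> S'. \<exists>u\<in>N f. (f \<in> S \<longrightarrow> u \<le> n f) \<and> (f \<in> S' \<longrightarrow> u \<le> n' f)"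
      using S S' filt_N filtered_set_lb2 by (metis Un_iff order_refl subsetD)
    then obtain n'' where n'': "\<And>f. f \<in> S \<union> S' \<Longrightarrow>
        n'' f \<in> N f \<and> (f \<in> S \<longrightarrow> n'' f \<le> n f) \<and> (f \<in> S' \<longrightarrow> n'' f \<le> n' f)"
      by metis
    have "\<exists>p\<in>X \<union> X'. \<forall>f\<in>S \<union> S'. m'' f \<le> f p \<and> f p \<le> n'' f"
      by (rule XX') (use S(1,2) S'(1,2) m'' n'' in auto)
    then obtain p where "p \<in> X \<union> X'" "\<forall>f\<in>S \<union> S'. m'' f \<le> f p \<and> f p \<le> n'' f" ..
    moreover from this have "\<forall>f\<in>S. m f \<le> f p \<and> f p \<le> n f" "\<forall>f\<in>S'. m' f \<le> f p \<and> f p \<le> n' f"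
      using m'' n'' by (meson UnI1 UnI2 order_trans)+
    ultimately show False using nS nS' by blast
  qed
qed

text \<open>In terms of complements, binary intersections of open sets are handled by adherence to a
  union of two sets, and arbitrary unions by monotonicity of adherence.\<close>

lemma istopology_FO: "istopology (\<lambda>U. FO1_closed F (- U))"
  unfolding istopology_def FO1_closed_iff
proof (intro conjI allI impI)
  fix U V l
  assume "\<forall>l. FO_adherent F (- U) l \<longrightarrow> l \<in> - U" "\<forall>l. FO_adherent F (- V) l \<longrightarrow> l \<in> - V"
    and "FO_adherent F (- (U \<inter> V)) l"
  then show "l \<in> - (U \<inter> V)"
    using FO_adherent_Un[of F "- U" "- V" l] by auto
next
  fix K l
  assume K: "\<forall>U\<in>K. \<forall>l. FO_adherent F (- U) l \<longrightarrow> l \<in> - U" and l: "FO_adherent F (- \<Union> K) l"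
  have "l \<in> - U" if "U \<in> K" for U
    using K that FO_adherent_mono[OF l, of "- U"] by blast
  then show "l \<in> - \<Union> K" by blast
qed

lemma openin_tau_FO: "openin (tau_FO F) U \<longleftrightarrow> FO1_closed F (- U)"
  by (simp add: tau_FO_def topology_inverse'[OF istopology_FO])

lemma topspace_tau_FO: "topspace (tau_FO F) = UNIV"
proof -
  have "openin (tau_FO F) UNIV"
    by (simp add: openin_tau_FO FO1_closed_iff not_FO_adherent_empty)
  then show ?thesis by (meson openin_subset top.extremum_unique)
qed

lemma closedin_tau_FO: "closedin (tau_FO F) C \<longleftrightarrow> FO1_closed F C"
  by (simp add: closedin_def topspace_tau_FO openin_tau_FO Compl_eq_Diff_UNIV[symmetric])

section \<open>Continuity and preservation of limits\<close>

lemma preserves_FO2_imp_preserves_FO1: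
  "preserves_FO2_ix TYPE('i) F Y \<phi> \<Longrightarrow> preserves_FO1_ix TYPE('i) F Y \<phi>"
  unfolding preserves_FO1_ix_def preserves_FO2_ix_def preserves_nets_def
  using FO1_converges_imp_FO2_converges by blast

text \<open>If the net were not eventually in the preimage of an open \<open>V\<close> containing
  \<open>\<phi> l\<close>, it would be frequently in the complement. Then \<open>l\<close> would be
  adherent to that closed complement and hence belong to it, a contradiction.\<close>

lemma continuous_map_imp_preserves_FO2:
  assumes cont: "continuous_map (tau_FO F) Y \<phi>"
  shows "preserves_FO2_ix TYPE('i) F Y \<phi>"
  unfolding preserves_FO2_ix_def preserves_nets_def
proof (intro allI impI, elim conjE)
  fix r :: "'i rel" and x l
  assume r: "directed_index r" and conv: "FO2_converges F r x l"
  show "limitin Y (\<lambda>g. \<phi> (x g)) (\<phi> l) (net_filter r)"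
    unfolding limitin_def
  proof (intro conjI allI impI, goal_cases)
    case 1
    show ?case using cont by (auto simp: continuous_map_def topspace_tau_FO)
  next
    case (2 V)
    then have "FO1_closed F (- {p. \<phi> p \<in> V})"
      using cont by (simp add: continuous_map_def topspace_tau_FO openin_tau_FO)
    then have "\<not> FO_adherent F (- {p. \<phi> p \<in> V}) l"
      using 2 by (auto simp: FO1_closed_iff)
    then have "\<not> frequently (\<lambda>g. x g \<in> - {p. \<phi> p \<in> V}) (net_filter r)"
      using FO2_converges_imp_FO_adherent[OF r conv] by blast
    then show ?case by (simp add: frequently_def)
  qed
qed

text \<open>The complement of the preimage of an open \<open>V\<close> is closed: an adherent point
  \<open>l\<close> is the limit of a net there, and \<open>\<phi> l\<close> in \<open>V\<close>
  would force the image net eventually into \<open>V\<close>.\<close>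

lemma preserves_FO1_imp_continuous_map:
  fixes F :: "('a::order \<Rightarrow> 'a) set"
  assumes "range \<phi> \<subseteq> topspace Y" and pres: "preserves_FO1 F Y \<phi>"
  shows "continuous_map (tau_FO F) Y \<phi>"
  unfolding continuous_map_def topspace_tau_FO openin_tau_FO FO1_closed_iff
proof (intro conjI allI impI)
  fix V l assume V: "openin Y V" and "FO_adherent F (- {p \<in> UNIV. \<phi> p \<in> V}) l"
  from this(2) obtain r :: "'a net_index rel" and x where r: "directed_index r"
    "\<forall>g\<in>Field r. x g \<in> - {p \<in> UNIV. \<phi> p \<in> V}" "FO1_converges F r x l"
    by (rule FO_adherent_imp_net)
  then have lim: "limitin Y (\<lambda>g. \<phi> (x g)) (\<phi> l) (net_filter r)"
    using pres by (auto simp: preserves_FO1_ix_def preserves_nets_def)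
  have "\<phi> l \<notin> V"
  proof
    assume "\<phi> l \<in> V"
    then have "eventually (\<lambda>g. \<phi> (x g) \<in> V) (net_filter r)"
      using lim V by (auto simp: limitin_def)
    with eventually_net_filter_Field[OF r(1)] have "eventually (\<lambda>_. False) (net_filter r)"
      by eventually_elim (use r(2) in auto)
    then show False using net_filter_neq_bot[OF r(1)] by simp
  qed
  then show "l \<in> - {p \<in> UNIV. \<phi> p \<in> V}" by simp
qed (use assms in auto)

text \<open>The clauses with \<open>TYPE('i)\<close> express that nets over other index types add
  nothing. The range condition says that \<open>\<phi>\<close> maps into the carrier of
  \<open>Y\<close>, which may be smaller than its type.\<close>

theorem corollary2p5:
  fixes F :: "('a::order \<Rightarrow> 'a) set"
  shows
    "(\<forall>X. FO1_closure F X = FO2_closure F X \<and>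
          FO1_closure_ix TYPE('i) F X \<subseteq> FO1_closure F X \<and>
          FO2_closure_ix TYPE('i) F X \<subseteq> FO2_closure F X) \<and>
     (\<forall>X. (FO1_closed F X \<longleftrightarrow> FO2_closed F X) \<and>
          (FO1_closed F X \<longrightarrow> FO1_closed_ix TYPE('i) F X) \<and>
          (FO2_closed F X \<longrightarrow> FO2_closed_ix TYPE('i) F X)) \<and>
     (\<forall>X :: 'a set.
          (O1_closed X \<longleftrightarrow> O2_closed X) \<and>
          (O1_closed X \<longleftrightarrow> FO1_closed {id} X) \<and>
          (O2_closed X \<longleftrightarrow> FO2_closed {id} X) \<and>
          (O1_closed X \<longrightarrow> O1_closed_ix TYPE('i) X) \<and>
          (O2_closed X \<longrightarrow> O2_closed_ix TYPE('i) X)) \<and>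
     (istopology (\<lambda>U. FO1_closed F (- U)) \<and>
      topspace (tau_FO F) = UNIV \<and>
      (\<forall>C. (closedin (tau_FO F) C \<longleftrightarrow> FO1_closed F C) \<and>
           (closedin (tau_FO F) C \<longleftrightarrow> FO2_closed F C))) \<and>
     (\<forall>(Y :: 'b topology) (\<phi> :: 'a \<Rightarrow> 'b). range \<phi> \<subseteq> topspace Y \<longrightarrow>
          (continuous_map (tau_FO F) Y \<phi> \<longleftrightarrow> preserves_FO2 F Y \<phi>) \<and>
          (preserves_FO2 F Y \<phi> \<longleftrightarrow> preserves_FO1 F Y \<phi>) \<and>
          (preserves_FO2 F Y \<phi> \<longrightarrow> preserves_FO2_ix TYPE('i) F Y \<phi>) \<and>
          (preserves_FO1 F Y \<phi> \<longrightarrow> preserves_FO1_ix TYPE('i) F Y \<phi>))"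
proof (intro conjI allI impI)
  show "FO1_closure F X = FO2_closure F X" for X
    by (simp add: FO1_closure_eq FO2_closure_eq)
  \<comment> \<open>Facts \<open>1\<close> to \<open>5\<close> are proved for an arbitrary family
    because the clauses on \<open>O1\<close> and \<open>O2\<close> use them at
    \<open>{id}\<close>.\<close>
  show 1: "FO1_closure_ix TYPE('i) F X \<subseteq> FO1_closure F X"
    and 2: "FO2_closure_ix TYPE('i) F X \<subseteq> FO2_closure F X" for F X
    using FO1_closure_ix_subset_FO2 FO2_closure_ix_subset
    unfolding FO1_closure_eq FO2_closure_eq by blast+
  show 3: "FO1_closed F X \<longleftrightarrow> FO2_closed F X" for F X
    by (simp add: FO1_closed_iff FO2_closed_iff)
  show 4: "FO1_closed_ix TYPE('i) F X" if "FO1_closed F X" for F X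
    using that 1 unfolding FO1_closed_ix_iff by blast
  show 5: "FO2_closed_ix TYPE('i) F X" if "FO2_closed F X" for F X
    using that 2 unfolding FO2_closed_ix_iff by blast
  fix X :: "'a set"
  show "O1_closed X \<longleftrightarrow> O2_closed X" "O1_closed X \<longleftrightarrow> FO1_closed {id} X"
    "O2_closed X \<longleftrightarrow> FO2_closed {id} X"
    by (simp_all add: O1_closed_ix_eq O2_closed_ix_eq 3)
  show "O1_closed_ix TYPE('i) X" if "O1_closed X"
    using that 4 by (simp add: O1_closed_ix_eq)
  show "O2_closed_ix TYPE('i) X" if "O2_closed X"
    using that 5 by (simp add: O2_closed_ix_eq)
next
  show "istopology (\<lambda>U. FO1_closed F (- U))" "topspace (tau_FO F) = UNIV"
    by (fact istopology_FO topspace_tau_FO)+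
  show "closedin (tau_FO F) C \<longleftrightarrow> FO1_closed F C" "closedin (tau_FO F) C \<longleftrightarrow> FO2_closed F C" for C
    by (simp_all add: closedin_tau_FO FO1_closed_iff FO2_closed_iff)
next
  fix Y :: "'b topology" and \<phi> :: "'a \<Rightarrow> 'b"
  assume \<phi>: "range \<phi> \<subseteq> topspace Y"
  note cont = preserves_FO1_imp_continuous_map[OF \<phi>, of F]
  show "continuous_map (tau_FO F) Y \<phi> \<longleftrightarrow> preserves_FO2 F Y \<phi>"
    "preserves_FO2 F Y \<phi> \<longleftrightarrow> preserves_FO1 F Y \<phi>"
    using cont continuous_map_imp_preserves_FO2 preserves_FO2_imp_preserves_FO1 by blast+
  \<comment> \<open>Continuity mentions no index type, so passing through it transfers preservation
    from \<open>'a net_index\<close> to \<open>'i\<close>.\<close>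
  show "preserves_FO2_ix TYPE('i) F Y \<phi>" if "preserves_FO2 F Y \<phi>"
    using that cont continuous_map_imp_preserves_FO2 preserves_FO2_imp_preserves_FO1 by blast
  show "preserves_FO1_ix TYPE('i) F Y \<phi>" if "preserves_FO1 F Y \<phi>"
    using that cont continuous_map_imp_preserves_FO2 preserves_FO2_imp_preserves_FO1 by blast
qed

end
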